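(* Let $L>0$, let $a\in C^2(\mathbb{R},\mathbb{R})$ be positive and $L$-periodic, let $f\in C^1(\mathbb{R}^2,\mathbb{R})$ satisfy $f(x+L,u)\equiv f(x,u)$ and $f(x,0)\equiv 0$, and let $p>0$ be an $L$-periodic stationary solution of $\partial_t u=\partial_x(a(x)\partial_x u)+f(x,u)$. If there exists a minimal propagating terrace $\mathcal{T}=((p_k)_{0\le k\le N},(U_k)_{1\le k\le N})$ connecting $0$ to $p$ whose speeds $c_1,\dots,c_N$ are all non zero, then it is the unique minimal propagating terrace connecting $0$ to $p$, up to time shifts.
   Context: Equation: (E) denotes $\partial_t u=\partial_x(a(x)\partial_x u)+f(x,u)$ for $x\in\mathbb{R}$. A stationary solution is a time-independent solution; an entire solution is a solution defined for all $(t,x)\in\mathbb{R}\times\mathbb{R}$. Inequalities such as $q<q'$ between functions are pointwise. Pulsating traveling waves: for $L$-periodic stationary solutions $q_2,q_1$ of (E), a pulsating traveling wave (or simply traveling wave) connecting $q_2$ to $q_1$ with speed $c\in\mathbb{R}$ is an entire solution of the form $u(t,x)=U(x-ct,x)$, where $U(z,x)$ is $L$-periodic in $x$ and satisfies $U(+\infty,\cdot)=q_2(\cdot)$, $U(-\infty,\cdot)=q_1(\cdot)$ (so $q_2$ is the limit on the right and $q_1$ the limit on the left). When a wave is denoted $U_k$, $U_k(t,x)$ stands for the entire solution. Propagating terrace: a propagating terrace connecting $0$ to $p$ is a pair of finite sequences $((p_k)_{0\le k\le N},(U_k)_{1\le k\le N})$ such that the $p_k$ are $L$-periodic stationary solutions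 with $p=p_0>p_1>\dots>p_N=0$; for each $1\le k\le N$, $U_k$ is a pulsating traveling wave connecting $p_k$ to $p_{k-1}$ with speed $c_k\in\mathbb{R}$; and $c_1\le c_2\le\dots\le c_N$. Steepness: $u_1(t,x)$ is steeper than $u_2(t,x)$ if for all $x_1,t_1,t_2\in\mathbb{R}$, $u_1(t_1,x_1)=u_2(t_2,x_1)$ implies $u_1(t_1,x)\ge u_2(t_2,x)$ for all $x\le x_1$ and $u_1(t_1,x)\le u_2(t_2,x)$ for all $x\ge x_1$. Semi-minimal and minimal: a terrace $((p_k),(U_k))$ is semi-minimal if for each $k$, $U_k$ is steeper than any other traveling wave connecting $p_k$ to $p_{k-1}$. It is minimal if it is semi-minimal and $\{p_k\}\subset\{q_k\}$ for any other propagating terrace $((q_k),(V_k))$ connecting $0$ to $p$. Equality up to time shifts: two terraces $((p_k),(U_k))$ and $((p'_k),(U'_k))$ are equal up to time shifts if they have the same sequence of stationary solutions and, for every $k$, $U'_k$ is a time shift of $U_k$ (the shift may depend on $k$). *)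

theory Defs
  imports "HOL-Analysis.Analysis"
begin

definition C1_real2 :: "(real \<Rightarrow> real \<Rightarrow> real) \<Rightarrow> bool" where
  "C1_real2 f \<longleftrightarrow>
     (\<exists>D :: real \<times> real \<Rightarrow> (real \<times> real) \<Rightarrow>\<^sub>L real.
        (\<forall>z. ((\<lambda>(x, u). f x u) has_derivative blinfun_apply (D z)) (at z)) \<and>
        continuous_on UNIV D)"

definition C2_real :: "(real \<Rightarrow> real) \<Rightarrow> bool" where
  "C2_real a \<longleftrightarrow>
     (\<exists>a'. (\<forall>x. (a has_real_derivative a' x) (at x)) \<and> a' C1_differentiable_on UNIV)"

(* Solutions are classical: u_t, u_x, u_xx exist and are jointly continuous on R x R.
   The arguments of u are time first, space second. *)
definition entire_solution ::
  "(real \<Rightarrow> real) \<Rightarrow> (real \<Rightarrow> real \<Rightarrow> real) \<Rightarrow> (real \<Rightarrow> real \<Rightarrow> real) \<Rightarrow> bool" where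
  "entire_solution a f u \<longleftrightarrow>
     (\<exists>ut ux uxx.
        (\<forall>t x. ((\<lambda>s. u s x) has_real_derivative ut t x) (at t)) \<and>
        (\<forall>t x. ((\<lambda>y. u t y) has_real_derivative ux t x) (at x)) \<and>
        (\<forall>t x. ((\<lambda>y. ux t y) has_real_derivative uxx t x) (at x)) \<and>
        continuous_on UNIV (\<lambda>(t, x). ut t x) \<and>
        continuous_on UNIV (\<lambda>(t, x). ux t x) \<and>
        continuous_on UNIV (\<lambda>(t, x). uxx t x) \<and>
        (\<forall>t x. ut t x = deriv (\<lambda>y. a y * ux t y) x + f x (u t x)))"

definition stationary_solution ::
  "(real \<Rightarrow> real) \<Rightarrow> (real \<Rightarrow> real \<Rightarrow> real) \<Rightarrow> (real \<Rightarrow> real) \<Rightarrow> bool" where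
  "stationary_solution a f q \<longleftrightarrow> entire_solution a f (\<lambda>t x. q x)"

definition periodic_stationary ::
  "real \<Rightarrow> (real \<Rightarrow> real) \<Rightarrow> (real \<Rightarrow> real \<Rightarrow> real) \<Rightarrow> (real \<Rightarrow> real) \<Rightarrow> bool" where
  "periodic_stationary L a f q \<longleftrightarrow>
     stationary_solution a f q \<and> (\<forall>x. q (x + L) = q x)"

(* The wave connects q2 (its limit on the right) to q1 (its limit on the left).
   The limits of U(z, .) as z tends to plus or minus infinity are uniform in x.
   If c = 0, u only determines the values U z x with z - x in the set of multiples
   of L; the remaining values of U are arbitrary, subject to the conditions below. *)
definition pulsating_wave ::
  "real \<Rightarrow> (real \<Rightarrow> real) \<Rightarrow> (real \<Rightarrow> real \<Rightarrow> real) \<Rightarrow> (real \<Rightarrow> real) \<Rightarrow> (real \<Rightarrow> real) \<Rightarrow>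
   real \<Rightarrow> (real \<Rightarrow> real \<Rightarrow> real) \<Rightarrow> bool" where
  "pulsating_wave L a f q2 q1 c u \<longleftrightarrow>
     periodic_stationary L a f q2 \<and> periodic_stationary L a f q1 \<and>
     entire_solution a f u \<and>
     (\<exists>U. (\<forall>t x. u t x = U (x - c * t) x) \<and>
          (\<forall>z x. U z (x + L) = U z x) \<and>
          uniform_limit UNIV U q2 at_top \<and>
          uniform_limit UNIV U q1 at_bot)"

definition steeper :: "(real \<Rightarrow> real \<Rightarrow> real) \<Rightarrow> (real \<Rightarrow> real \<Rightarrow> real) \<Rightarrow> bool" where
  "steeper u1 u2 \<longleftrightarrow>
     (\<forall>x1 t1 t2. u1 t1 x1 = u2 t2 x1 \<longrightarrow>
        (\<forall>x\<le>x1. u1 t1 x \<ge> u2 t2 x) \<and> (\<forall>x\<ge>x1. u1 t1 x \<le> u2 t2 x))"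

(* The stationary solutions p_0, ..., p_N are ps ! 0, ..., ps ! N.  The waves U_1, ..., U_N
   and speeds c_1, ..., c_N are Us ! 0, ..., Us ! (N - 1) and cs ! 0, ..., cs ! (N - 1). *)
definition terrace_with_speeds ::
  "real \<Rightarrow> (real \<Rightarrow> real) \<Rightarrow> (real \<Rightarrow> real \<Rightarrow> real) \<Rightarrow> (real \<Rightarrow> real) \<Rightarrow>
   (real \<Rightarrow> real) list \<Rightarrow> (real \<Rightarrow> real \<Rightarrow> real) list \<Rightarrow> real list \<Rightarrow> bool" where
  "terrace_with_speeds L a f p ps Us cs \<longleftrightarrow>
     length ps = Suc (length Us) \<and> length cs = length Us \<and>
     ps ! 0 = p \<and> ps ! length Us = (\<lambda>x. 0) \<and>
     (\<forall>q\<in>set ps. periodic_stationary L a f q) \<and>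
     (\<forall>k<length Us. \<forall>x. (ps ! k) x > (ps ! Suc k) x) \<and>
     (\<forall>k<length Us. pulsating_wave L a f (ps ! Suc k) (ps ! k) (cs ! k) (Us ! k)) \<and>
     sorted cs"

definition propagating_terrace ::
  "real \<Rightarrow> (real \<Rightarrow> real) \<Rightarrow> (real \<Rightarrow> real \<Rightarrow> real) \<Rightarrow> (real \<Rightarrow> real) \<Rightarrow>
   (real \<Rightarrow> real) list \<Rightarrow> (real \<Rightarrow> real \<Rightarrow> real) list \<Rightarrow> bool" where
  "propagating_terrace L a f p ps Us \<longleftrightarrow> (\<exists>cs. terrace_with_speeds L a f p ps Us cs)"

definition semi_minimal_terrace ::
  "real \<Rightarrow> (real \<Rightarrow> real) \<Rightarrow> (real \<Rightarrow> real \<Rightarrow> real) \<Rightarrow> (real \<Rightarrow> real) \<Rightarrow>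
   (real \<Rightarrow> real) list \<Rightarrow> (real \<Rightarrow> real \<Rightarrow> real) list \<Rightarrow> bool" where
  "semi_minimal_terrace L a f p ps Us \<longleftrightarrow>
     propagating_terrace L a f p ps Us \<and>
     (\<forall>k<length Us. \<forall>c V. pulsating_wave L a f (ps ! Suc k) (ps ! k) c V \<and> V \<noteq> Us ! k \<longrightarrow>
        steeper (Us ! k) V)"

definition minimal_terrace ::
  "real \<Rightarrow> (real \<Rightarrow> real) \<Rightarrow> (real \<Rightarrow> real \<Rightarrow> real) \<Rightarrow> (real \<Rightarrow> real) \<Rightarrow>
   (real \<Rightarrow> real) list \<Rightarrow> (real \<Rightarrow> real \<Rightarrow> real) list \<Rightarrow> bool" where
  "minimal_terrace L a f p ps Us \<longleftrightarrow>
     semi_minimal_terrace L a f p ps Us \<and>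
     (\<forall>qs Vs. propagating_terrace L a f p qs Vs \<and> (qs, Vs) \<noteq> (ps, Us) \<longrightarrow> set ps \<subseteq> set qs)"

definition equal_up_to_time_shifts ::
  "(real \<Rightarrow> real) list \<Rightarrow> (real \<Rightarrow> real \<Rightarrow> real) list \<Rightarrow>
   (real \<Rightarrow> real) list \<Rightarrow> (real \<Rightarrow> real \<Rightarrow> real) list \<Rightarrow> bool" where
  "equal_up_to_time_shifts ps Us ps' Us' \<longleftrightarrow>
     ps = ps' \<and> length Us = length Us' \<and>
     (\<forall>k<length Us. \<exists>s. \<forall>t x. (Us' ! k) t x = (Us ! k) (t + s) x)"

end

theory Submission
  imports Defs
begin

text \<open>
  Two minimal terraces contain each other's stationary solutions, so these sequences agree, and two
  distinct waves \<open>u\<close>, \<open>v\<close> with the same end states are steeper than each other.  Hence, if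
  \<open>u t\<^sub>1\<close> and \<open>v t\<^sub>2\<close> meet at one point, they coincide.  As \<open>u\<close> has nonzero speed, every
  profile \<open>v t\<close> meets some \<open>u (\<tau> t)\<close>, by the intermediate value theorem.  Forward uniqueness for
  the parabolic equation (a maximum principle for \<open>u - v\<close>, which vanishes at spatial infinity)
  then shows that the profiles of \<open>u\<close> at different times differ, and that \<open>\<tau> t = \<tau> 0 + t\<close>.
\<close>

section \<open>Lists sorted by an asymmetric relation\<close>

lemma sorted_wrt_set_unique:
  assumes "asymp R" "sorted_wrt R xs" "sorted_wrt R ys" "set xs = set ys"
  shows "xs = ys"
  using assms(2-)
proof (induction xs arbitrary: ys)
  case Nil
  then show ?case by simp
next
  case (Cons x xs)
  then obtain y ys' where ys: "ys = y # ys'" by (cases ys) auto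
  have irr: "\<not> R z z" for z
    using assms(1) by (meson asympD)
  \<comment> \<open>Two different heads would each lie in the other list's tail, so each would
    precede the other, against asymmetry.\<close>
  have "x = y"
  proof (rule ccontr)
    assume "x \<noteq> y"
    with Cons.prems ys have "x \<in> set ys'" "y \<in> set xs" by auto
    with Cons.prems ys have "R y x" "R x y" by auto
    with assms(1) show False by (meson asympD)
  qed
  moreover have "x \<notin> set xs" "y \<notin> set ys'"
    using Cons.prems ys irr by auto
  ultimately have "set xs = set ys'"
    using Cons.prems ys by auto
  with Cons ys \<open>x = y\<close> show ?case by simp
qed

section \<open>Uniform bounds from periodicity\<close>

lemma continuous_periodic_bounded:
  fixes q :: "real \<Rightarrow> real"
  assumes "L > 0" "continuous_on UNIV q" "\<And>x. q (x + L) = q x"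
  obtains B where "\<And>x. \<bar>q x\<bar> \<le> B"
proof -
  have "compact (q ` {0..L})"
    by (intro compact_continuous_image continuous_on_subset[OF assms(2)]) auto
  then obtain B where B: "\<And>x. x \<in> {0..L} \<Longrightarrow> \<bar>q x\<bar> \<le> B"
    by (metis bounded_iff compact_imp_bounded imageI real_norm_def)
  interpret q: periodic_fun_simple q L by unfold_locales (use assms in auto)
  have "\<bar>q x\<bar> \<le> B" for x
  proof -
    have "q x = q (x - of_int \<lfloor>x / L\<rfloor> * L)"
      by (simp add: q.minus_of_int)
    moreover have "x - of_int \<lfloor>x / L\<rfloor> * L \<in> {0..L}"
      using floor_divide_lower[OF assms(1), of x] floor_divide_upper[OF assms(1), of x]
      by (simp add: algebra_simps)
    ultimately show ?thesis using B by metis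
  qed
  then show thesis using that by blast
qed

text \<open>The derivative of \<open>f\<close> is bounded on the compact set
  \<open>{0..L} \<times> {-M..M}\<close>, so the mean value inequality in \<open>u\<close> gives one
  constant for a whole period; periodicity extends it to every \<open>x\<close>. The constant
  depends on the bound \<open>M\<close>.\<close>

lemma C1_real2_lipschitz:
  assumes "L > 0" "C1_real2 f" "\<And>x u. f (x + L) u = f x u"
  obtains K where "\<And>x u v. \<bar>u\<bar> \<le> M \<Longrightarrow> \<bar>v\<bar> \<le> M \<Longrightarrow> \<bar>f x u - f x v\<bar> \<le> K * \<bar>u - v\<bar>"
proof -
  obtain D :: "real \<times> real \<Rightarrow> (real \<times> real) \<Rightarrow>\<^sub>L real" where
    D: "\<And>z. ((\<lambda>(x, u). f x u) has_derivative blinfun_apply (D z)) (at z)"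
    and cD: "continuous_on UNIV D"
    using assms(2) unfolding C1_real2_def by blast
  have "compact (D ` ({0..L} \<times> {-M..M}))"
    by (intro compact_continuous_image continuous_on_subset[OF cD] compact_Times) auto
  then obtain K where K: "\<And>z. z \<in> {0..L} \<times> {-M..M} \<Longrightarrow> norm (D z) \<le> K"
    by (metis bounded_iff compact_imp_bounded imageI)
  have base: "\<bar>f x u - f x v\<bar> \<le> K * \<bar>u - v\<bar>"
    if "x \<in> {0..L}" "\<bar>u\<bar> \<le> M" "\<bar>v\<bar> \<le> M" for x u v
  proof -
    have der: "(f x has_derivative (\<lambda>h. D (x, w) (0, h))) (at w within {-M..M})" for w
    proof -
      have "((\<lambda>w. (x, w)) has_derivative (\<lambda>h. (0, h))) (at w within {-M..M})"
        by (auto intro!: derivative_eq_intros)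
      from has_derivative_compose[OF this D] show ?thesis by simp
    qed
    have onorm: "onorm (\<lambda>h. D (x, w) (0, h)) \<le> K" if "w \<in> {-M..M}" for w
    proof (rule onorm_bound)
      show "0 \<le> K" using K[of "(x, w)"] that \<open>x \<in> {0..L}\<close> norm_ge_zero order_trans by blast
      fix h :: real
      have "norm (D (x, w) (0, h)) \<le> norm (D (x, w)) * norm (0 :: real, h)"
        by (rule norm_blinfun)
      also have "\<dots> \<le> K * norm h"
        using K[of "(x, w)"] that \<open>x \<in> {0..L}\<close> by (auto intro!: mult_right_mono)
      finally show "norm (D (x, w) (0, h)) \<le> K * norm h" .
    qed
    have "norm (f x u - f x v) \<le> K * norm (u - v)"
      by (rule differentiable_bound[OF _ der onorm]) (use that in auto)
    then show ?thesis by simp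
  qed
  have "\<bar>f x u - f x v\<bar> \<le> K * \<bar>u - v\<bar>" if "\<bar>u\<bar> \<le> M" "\<bar>v\<bar> \<le> M" for x u v
  proof -
    have f: "f x w = f (x - of_int \<lfloor>x / L\<rfloor> * L) w" for w
    proof -
      interpret fw: periodic_fun_simple "\<lambda>x. f x w" L by unfold_locales (use assms in auto)
      show ?thesis by (simp add: fw.minus_of_int)
    qed
    have "x - of_int \<lfloor>x / L\<rfloor> * L \<in> {0..L}"
      using floor_divide_lower[OF assms(1), of x] floor_divide_upper[OF assms(1), of x]
      by (simp add: algebra_simps)
    from base[OF this that] show ?thesis by (simp only: f[symmetric])
  qed
  then show thesis using that by blast
qed

section \<open>Regularity of entire solutions and the expanded equation\<close>

lemma continuous_on_partials:
  fixes u ut ux :: "real \<Rightarrow> real \<Rightarrow> real"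
  assumes t: "\<And>t x. ((\<lambda>s. u s x) has_real_derivative ut t x) (at t)"
    and x: "\<And>t x. ((\<lambda>y. u t y) has_real_derivative ux t x) (at x)"
    and cx: "continuous_on UNIV (\<lambda>(t, x). ux t x)"
  shows "continuous_on UNIV (\<lambda>(t, x). u t x)"
proof -
  \<comment> \<open>\<open>has_derivative_partialsI\<close> takes one partial derivative as a
    continuous family of bounded linear maps; \<open>B t x\<close> is multiplication by
    \<open>ux t x\<close>.\<close>
  define B where "B = (\<lambda>t x. blinfun_scaleR_left (ux t x))"
  have "((\<lambda>(t, x). u t x) has_derivative (\<lambda>(h, k). ut t x * h + blinfun_apply (B t x) k))
      (at (t, x) within UNIV \<times> UNIV)" for t x
  proof (rule has_derivative_partialsI[where fx = "\<lambda>h. ut t x * h" and fy = B])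
    show "((\<lambda>t. u t x) has_derivative (\<lambda>h. ut t x * h)) (at t within UNIV)"
      using t[of x t] by (simp add: has_field_derivative_def)
    show "((\<lambda>y. u t y) has_derivative blinfun_apply (B t x)) (at x within UNIV)" for t x
      using x[of t x, unfolded has_field_derivative_def]
      by (rule has_derivative_eq_rhs) (simp add: B_def fun_eq_iff)
    have "continuous_on UNIV (\<lambda>z. blinfun_scaleR_left (case z of (t, x) \<Rightarrow> ux t x))"
      by (rule bounded_linear.continuous_on[OF bounded_linear_blinfun_scaleR_left cx])
    then have "continuous_on UNIV (\<lambda>(t, x). B t x)"
      by (simp add: B_def case_prod_beta)
    then show "continuous (at (t, x) within UNIV \<times> UNIV) (\<lambda>(t, x). B t x)"
      by (simp add: continuous_on_eq_continuous_within)
  qed auto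
  then have "continuous (at z) (\<lambda>(t, x). u t x)" for z
    by (cases z) (metis UNIV_Times_UNIV has_derivative_continuous)
  then show ?thesis by (simp add: continuous_at_imp_continuous_on)
qed

text \<open>Joint continuity of \<open>u\<close> is not a clause of \<open>entire_solution\<close>;
  it follows from differentiability, as both partial derivatives exist and \<open>ux\<close> is
  jointly continuous.\<close>

lemma entire_solution_continuous:
  assumes "entire_solution a f u"
  shows "continuous_on UNIV (\<lambda>(t, x). u t x)"
  using assms unfolding entire_solution_def by (metis continuous_on_partials)

lemma entire_solution_continuous_time:
  assumes "entire_solution a f u"
  shows "continuous_on A (\<lambda>t. u t x)"
  using continuous_on_compose2[OF entire_solution_continuous[OF assms], of A "\<lambda>t. (t, x)"]
  by (simp add: continuous_on_Pair)

lemma entire_solution_continuous_space: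
  assumes "entire_solution a f u"
  shows "continuous_on A (u t)"
  using continuous_on_compose2[OF entire_solution_continuous[OF assms], of A "\<lambda>x. (t, x)"]
  by (simp add: continuous_on_Pair)

lemma periodic_stationary_continuous:
  "periodic_stationary L a f q \<Longrightarrow> continuous_on A q"
  unfolding periodic_stationary_def stationary_solution_def
  using entire_solution_continuous_space by blast

text \<open>In this non-divergence form a spatial maximum of a difference of two solutions removes
  the first-order term and gives the second-order term a sign.\<close>

lemma entire_solution_equation:
  assumes "C2_real a" "entire_solution a f u"
  obtains ut ux uxx where
    "\<And>t x. ((\<lambda>s. u s x) has_real_derivative ut t x) (at t)"
    "\<And>t x. ((\<lambda>y. u t y) has_real_derivative ux t x) (at x)"
    "\<And>t x. ((\<lambda>y. ux t y) has_real_derivative uxx t x) (at x)"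
    "\<And>t x. ut t x = deriv a x * ux t x + a x * uxx t x + f x (u t x)"
proof -
  obtain ut ux uxx where
    1: "\<forall>t x. ((\<lambda>s. u s x) has_real_derivative ut t x) (at t)"
    "\<forall>t x. ((\<lambda>y. u t y) has_real_derivative ux t x) (at x)"
    "\<forall>t x. ((\<lambda>y. ux t y) has_real_derivative uxx t x) (at x)"
    "\<forall>t x. ut t x = deriv (\<lambda>y. a y * ux t y) x + f x (u t x)"
    using assms(2) unfolding entire_solution_def by blast
  note 1 = 1[rule_format]
  have a: "(a has_real_derivative deriv a x) (at x)" for x
    using assms(1) unfolding C2_real_def by (metis DERIV_imp_deriv)
  have "deriv (\<lambda>y. a y * ux t y) x = deriv a x * ux t x + a x * uxx t x" for t x
    by (rule DERIV_imp_deriv) (auto intro!: derivative_eq_intros a 1(2,3))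
  then have "ut t x = deriv a x * ux t x + a x * uxx t x + f x (u t x)" for t x
    using 1(4) by metis
  then show thesis by (rule that[OF 1(1-3)])
qed

section \<open>Parabolic maximum principle\<close>

lemma second_derivative_nonpos_at_max:
  fixes g :: "real \<Rightarrow> real"
  assumes g: "\<And>x. (g has_real_derivative g' x) (at x)"
    and g': "(g' has_real_derivative l) (at x0)"
    and max: "\<And>x. g x \<le> g x0"
  shows "l \<le> 0"
proof (rule ccontr)
  assume "\<not> l \<le> 0"
  then obtain d where d: "d > 0" "\<And>h. 0 < h \<Longrightarrow> h < d \<Longrightarrow> g' x0 < g' (x0 + h)"
    using DERIV_pos_inc_right[OF g'] by (metis not_le)
  have "g' x0 = 0"
    using DERIV_local_max[OF g, of 1 x0] max by simp
  \<comment> \<open>Since \<open>g'\<close> vanishes at \<open>x0\<close> and increases there, it is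
    positive just to the right, where \<open>g\<close> must therefore rise.\<close>
  have "g x0 < g (x0 + d / 2)"
  proof (rule DERIV_pos_imp_increasing_open[where f = g])
    fix x assume "x0 < x" "x < x0 + d / 2"
    then have "g' x > 0" using d(2)[of "x - x0"] d(1) \<open>g' x0 = 0\<close> by simp
    with g show "\<exists>y. (g has_real_derivative y) (at x) \<and> 0 < y" by blast
  qed (use d g in \<open>auto intro: DERIV_isCont continuous_at_imp_continuous_on\<close>)
  with max[of "x0 + d / 2"] show False by simp
qed

text \<open>The decay hypothesis \<open>far\<close> confines a positive supremum of the weighted
  difference \<open>z\<close> to a compact rectangle, so it is attained. At that maximum the
  equation forces a negative time derivative, so \<open>z\<close> was larger slightly
  earlier.\<close>

lemma parabolic_comparison:
  assumes a: "C2_real a" "\<And>x. a x > 0"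
    and sol: "entire_solution a f u" "entire_solution a f v"
    and lip: "\<And>t x. 0 \<le> t \<Longrightarrow> t \<le> T \<Longrightarrow> \<bar>f x (u t x) - f x (v t x)\<bar> \<le> K * \<bar>u t x - v t x\<bar>"
    and far: "\<And>e. e > 0 \<Longrightarrow> \<exists>R. \<forall>t x. 0 \<le> t \<longrightarrow> t \<le> T \<longrightarrow> R \<le> \<bar>x\<bar> \<longrightarrow> \<bar>u t x - v t x\<bar> \<le> e"
    and init: "\<And>x. u 0 x \<le> v 0 x"
    and s: "0 \<le> s" "s \<le> T"
  shows "u s y \<le> v s y"
proof (rule ccontr)
  assume contra: "\<not> u s y \<le> v s y"
  obtain ut ux uxx where U:
    "\<And>t x. ((\<lambda>s. u s x) has_real_derivative ut t x) (at t)"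
    "\<And>t x. ((\<lambda>y. u t y) has_real_derivative ux t x) (at x)"
    "\<And>t x. ((\<lambda>y. ux t y) has_real_derivative uxx t x) (at x)"
    "\<And>t x. ut t x = deriv a x * ux t x + a x * uxx t x + f x (u t x)"
    using entire_solution_equation[OF a(1) sol(1)] by metis
  obtain vt vx vxx where V:
    "\<And>t x. ((\<lambda>s. v s x) has_real_derivative vt t x) (at t)"
    "\<And>t x. ((\<lambda>y. v t y) has_real_derivative vx t x) (at x)"
    "\<And>t x. ((\<lambda>y. vx t y) has_real_derivative vxx t x) (at x)"
    "\<And>t x. vt t x = deriv a x * vx t x + a x * vxx t x + f x (v t x)"
    using entire_solution_equation[OF a(1) sol(2)] by metis
  \<comment> \<open>Exceeding the Lipschitz constant by 1 leaves at most \<open>- w\<close> at the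
    maximum, where \<open>w\<close> is the unweighted difference there: the weight beats the
    reaction term.\<close>
  define m where "m = \<bar>K\<bar> + 1"
  have "m > 0" by (simp add: m_def add_nonneg_pos)
  define z where "z = (\<lambda>t x. exp (- m * t) * (u t x - v t x))"
  have zpos: "z s y > 0"
    using contra by (simp add: z_def)
  \<comment> \<open>Outside \<open>R\<close> the function \<open>z\<close> stays below
    \<open>z s y\<close>, so its maximum over the rectangle \<open>?Q\<close> is its maximum over
    the whole strip of times in \<open>[0, T]\<close>.\<close>
  obtain R where R: "\<And>t x. 0 \<le> t \<Longrightarrow> t \<le> T \<Longrightarrow> R \<le> \<bar>x\<bar> \<Longrightarrow> \<bar>u t x - v t x\<bar> \<le> z s y / 2"
    using far[of "z s y / 2"] zpos by auto
  have out: "z t x < z s y" if "0 \<le> t" "t \<le> T" "R \<le> \<bar>x\<bar>" for t x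
  proof -
    have "z t x \<le> exp (- m * t) * \<bar>u t x - v t x\<bar>"
      unfolding z_def by (intro mult_left_mono) auto
    also have "\<dots> \<le> 1 * (z s y / 2)"
      using R[OF that] that(1) \<open>m > 0\<close> by (intro mult_mono) auto
    finally show ?thesis using zpos by simp
  qed
  let ?Q = "{0..T} \<times> {-\<bar>R\<bar>..\<bar>R\<bar>}"
  have "continuous_on UNIV (\<lambda>p. z (fst p) (snd p))"
    using entire_solution_continuous[OF sol(1)] entire_solution_continuous[OF sol(2)]
    unfolding z_def case_prod_beta by (intro continuous_intros)
  then have "continuous_on ?Q (\<lambda>p. z (fst p) (snd p))"
    by (rule continuous_on_subset) simp
  moreover have inQ: "(s, y) \<in> ?Q"
    using out[OF s, of y] s by (cases "R \<le> \<bar>y\<bar>") auto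
  ultimately obtain p where p: "p \<in> ?Q" "\<And>q. q \<in> ?Q \<Longrightarrow> z (fst q) (snd q) \<le> z (fst p) (snd p)"
    using continuous_attains_sup[of ?Q "\<lambda>p. z (fst p) (snd p)"] by (auto simp: compact_Times)
  define t0 x0 where "t0 = fst p" and "x0 = snd p"
  have t0: "0 \<le> t0" "t0 \<le> T" using p(1) by (auto simp: t0_def)
  have zmax: "z t x \<le> z t0 x0" if "0 \<le> t" "t \<le> T" for t x
  proof (cases "(t, x) \<in> ?Q")
    case True
    then show ?thesis using p(2)[of "(t, x)"] by (simp add: t0_def x0_def)
  next
    case False
    then have "z t x < z s y" using that by (intro out) auto
    with p(2)[OF inQ] show ?thesis by (simp add: t0_def x0_def)
  qed
  have z0: "z t0 x0 > 0" using zmax[OF s, of y] zpos by simp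
  define w where "w = u t0 x0 - v t0 x0"
  have w: "w > 0" using z0 by (simp add: w_def z_def zero_less_mult_iff)
  \<comment> \<open>The initial ordering keeps the maximum away from time 0, leaving room to step
    back in time.\<close>
  have "t0 \<noteq> 0" using w init[of x0] by (auto simp: w_def)
  then have t0pos: "t0 > 0" using t0 by simp
  have wmax: "u t0 x - v t0 x \<le> u t0 x0 - v t0 x0" for x
    using zmax[OF t0, of x] by (simp add: z_def)
  have "ux t0 x0 - vx t0 x0 = 0"
    using DERIV_local_max[OF DERIV_diff[OF U(2)[of t0 x0] V(2)[of t0 x0]], of 1] wmax by simp
  moreover have "uxx t0 x0 - vxx t0 x0 \<le> 0"
    by (rule second_derivative_nonpos_at_max[OF DERIV_diff[OF U(2)[of t0] V(2)[of t0]]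
          DERIV_diff[OF U(3)[of t0 x0] V(3)[of t0 x0]] wmax])
  moreover have "f x0 (u t0 x0) - f x0 (v t0 x0) \<le> \<bar>K\<bar> * w"
  proof -
    have "f x0 (u t0 x0) - f x0 (v t0 x0) \<le> K * w"
      using lip[OF t0, of x0] w by (simp add: w_def)
    also have "\<dots> \<le> \<bar>K\<bar> * w" using w by (intro mult_right_mono) auto
    finally show ?thesis .
  qed
  moreover have "a x0 * (uxx t0 x0 - vxx t0 x0) \<le> 0"
    using a(2)[of x0] \<open>uxx t0 x0 - vxx t0 x0 \<le> 0\<close> by (simp add: mult_le_0_iff)
  moreover have "ut t0 x0 - vt t0 x0 = deriv a x0 * (ux t0 x0 - vx t0 x0)
      + a x0 * (uxx t0 x0 - vxx t0 x0) + (f x0 (u t0 x0) - f x0 (v t0 x0))"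
    unfolding U(4) V(4) by (simp add: algebra_simps)
  ultimately have wt: "ut t0 x0 - vt t0 x0 - m * w < 0"
    using w by (simp add: m_def algebra_simps)
  have "((\<lambda>t. z t x0) has_real_derivative exp (- m * t0) * (ut t0 x0 - vt t0 x0 - m * w)) (at t0)"
    unfolding z_def w_def
    by (rule derivative_eq_intros U(1) V(1) refl)+ (simp add: algebra_simps)
  moreover have "exp (- m * t0) * (ut t0 x0 - vt t0 x0 - m * w) < 0"
    using wt by (simp add: mult_pos_neg)
  ultimately obtain d where d: "d > 0" "\<And>h. 0 < h \<Longrightarrow> h < d \<Longrightarrow> z t0 x0 < z (t0 - h) x0"
    using DERIV_neg_dec_left by blast
  \<comment> \<open>The step back is short enough for the derivative estimate and does not pass time
    0.\<close>
  define h where "h = min (d / 2) t0"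
  have "0 < h" "h < d" "h \<le> t0" using d(1) t0pos by (auto simp: h_def)
  then show False using d(2)[of h] zmax[of "t0 - h" x0] t0 by simp
qed

section \<open>Time shifts, asymptotics and boundedness of waves\<close>

lemma entire_solution_time_shift:
  assumes "entire_solution a f u"
  shows "entire_solution a f (\<lambda>t. u (t + s))"
proof -
  obtain ut ux uxx where
    1: "\<forall>t x. ((\<lambda>s. u s x) has_real_derivative ut t x) (at t)"
    "\<forall>t x. ((\<lambda>y. u t y) has_real_derivative ux t x) (at x)"
    "\<forall>t x. ((\<lambda>y. ux t y) has_real_derivative uxx t x) (at x)"
    "\<forall>t x. ut t x = deriv (\<lambda>y. a y * ux t y) x + f x (u t x)"
    and c: "continuous_on UNIV (\<lambda>(t, x). ut t x)" "continuous_on UNIV (\<lambda>(t, x). ux t x)"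
      "continuous_on UNIV (\<lambda>(t, x). uxx t x)"
    using assms unfolding entire_solution_def by blast
  note 1 = 1[rule_format]
  have sh: "continuous_on UNIV (\<lambda>(t, x). g (t + s) x)"
    if "continuous_on UNIV (\<lambda>(t, x). g t x)" for g :: "real \<Rightarrow> real \<Rightarrow> real"
    using continuous_on_compose2[OF that, of UNIV "\<lambda>p. (fst p + s, snd p)"]
    by (simp add: case_prod_beta continuous_on_Pair continuous_on_fst continuous_on_snd continuous_on_add)
  have "((\<lambda>t. u (t + s) x) has_real_derivative ut (t + s) x) (at t)" for t x
    using 1(1)[of x "t + s"] by (simp add: DERIV_shift)
  then show ?thesis
    unfolding entire_solution_def
    by (intro exI[of _ "\<lambda>t. ut (t + s)"] exI[of _ "\<lambda>t. ux (t + s)"] exI[of _ "\<lambda>t. uxx (t + s)"])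
      (auto intro!: 1 sh c)
qed

text \<open>A shift of time by \<open>s\<close> moves the first argument of the profile by
  \<open>c * s\<close>, which does not affect its limits. This allows two waves to be compared from
  different starting times.\<close>

lemma pulsating_wave_time_shift:
  assumes "pulsating_wave L a f q2 q1 c u"
  shows "pulsating_wave L a f q2 q1 c (\<lambda>t. u (t + s))"
proof -
  obtain U where U: "\<And>t x. u t x = U (x - c * t) x" "\<And>z x. U z (x + L) = U z x"
    "uniform_limit UNIV U q2 at_top" "uniform_limit UNIV U q1 at_bot"
    using assms unfolding pulsating_wave_def by blast
  have "filterlim (\<lambda>z. z - c * s) at_top at_top" "filterlim (\<lambda>z. z - c * s) at_bot at_bot"
    by (auto simp: filterlim_at_top filterlim_at_bot eventually_at_top_linorder
        eventually_at_bot_linorder le_diff_eq diff_le_eq)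
  from filterlim_compose[OF U(3) this(1)] filterlim_compose[OF U(4) this(2)]
  have "uniform_limit UNIV (\<lambda>z. U (z - c * s)) q2 at_top"
    "uniform_limit UNIV (\<lambda>z. U (z - c * s)) q1 at_bot"
    by simp_all
  then show ?thesis
    using assms U entire_solution_time_shift[of a f u s]
    unfolding pulsating_wave_def
    by (auto intro!: exI[of _ "\<lambda>z. U (z - c * s)"] simp: algebra_simps)
qed

text \<open>Eliminates the profile \<open>U\<close>: since its limits are uniform in
  \<open>x\<close>, one threshold in the moving coordinate serves all times and places.\<close>

lemma pulsating_wave_far:
  assumes "pulsating_wave L a f q2 q1 c u" "e > 0"
  obtains Z where "\<And>t x. x - c * t \<ge> Z \<Longrightarrow> \<bar>u t x - q2 x\<bar> < e"
    "\<And>t x. x - c * t \<le> - Z \<Longrightarrow> \<bar>u t x - q1 x\<bar> < e"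
proof -
  obtain U where U: "\<And>t x. u t x = U (x - c * t) x"
    "uniform_limit UNIV U q2 at_top" "uniform_limit UNIV U q1 at_bot"
    using assms unfolding pulsating_wave_def by blast
  obtain Z1 where Z1: "\<And>z x. z \<ge> Z1 \<Longrightarrow> dist (U z x) (q2 x) < e"
    using uniform_limitD[OF U(2) assms(2)] unfolding eventually_at_top_linorder by auto
  obtain Z2 where Z2: "\<And>z x. z \<le> Z2 \<Longrightarrow> dist (U z x) (q1 x) < e"
    using uniform_limitD[OF U(3) assms(2)] unfolding eventually_at_bot_linorder by auto
  show thesis
    by (rule that[of "max Z1 (- Z2)"]) (use Z1 Z2 in \<open>auto simp: U(1) dist_real_def\<close>)
qed

text \<open>On a bounded time interval the moving coordinate differs from \<open>x\<close> by at
  most \<open>\<bar>c\<bar> * \<bar>T\<bar>\<close>, so the threshold can be put in \<open>x\<close>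
  itself.\<close>

lemma pulsating_wave_far_bounded_time:
  assumes "pulsating_wave L a f q2 q1 c u" "e > 0"
  obtains R where "R > 0"
    "\<And>t x. 0 \<le> t \<Longrightarrow> t \<le> T \<Longrightarrow> R \<le> x \<Longrightarrow> \<bar>u t x - q2 x\<bar> < e"
    "\<And>t x. 0 \<le> t \<Longrightarrow> t \<le> T \<Longrightarrow> x \<le> - R \<Longrightarrow> \<bar>u t x - q1 x\<bar> < e"
proof -
  obtain Z where Z: "\<And>t x. x - c * t \<ge> Z \<Longrightarrow> \<bar>u t x - q2 x\<bar> < e"
    "\<And>t x. x - c * t \<le> - Z \<Longrightarrow> \<bar>u t x - q1 x\<bar> < e"
    using pulsating_wave_far[OF assms] by metis
  have ct: "\<bar>c * t\<bar> \<le> \<bar>c\<bar> * \<bar>T\<bar>" if "0 \<le> t" "t \<le> T" for t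
    using that by (simp add: abs_mult mult_left_mono)
  show thesis
  proof (rule that[of "\<bar>Z\<bar> + \<bar>c\<bar> * \<bar>T\<bar> + 1"])
    show "\<bar>Z\<bar> + \<bar>c\<bar> * \<bar>T\<bar> + 1 > 0" by (simp add: add_nonneg_pos)
    show "\<bar>u t x - q2 x\<bar> < e" if "0 \<le> t" "t \<le> T" "\<bar>Z\<bar> + \<bar>c\<bar> * \<bar>T\<bar> + 1 \<le> x" for t x
      using ct[OF that(1,2)] that(3) by (intro Z(1)) linarith
    show "\<bar>u t x - q1 x\<bar> < e" if "0 \<le> t" "t \<le> T" "x \<le> - (\<bar>Z\<bar> + \<bar>c\<bar> * \<bar>T\<bar> + 1)" for t x
      using ct[OF that(1,2)] that(3) by (intro Z(2)) linarith
  qed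
qed

text \<open>Far out the wave is within 1 of a bounded periodic end state; what remains is a compact
  rectangle.\<close>

lemma pulsating_wave_bounded:
  assumes "L > 0" "pulsating_wave L a f q2 q1 c u"
  obtains M where "\<And>t x. 0 \<le> t \<Longrightarrow> t \<le> T \<Longrightarrow> \<bar>u t x\<bar> \<le> M"
proof -
  have q: "periodic_stationary L a f q2" "periodic_stationary L a f q1" "entire_solution a f u"
    using assms(2) unfolding pulsating_wave_def by auto
  obtain B2 where B2: "\<And>x. \<bar>q2 x\<bar> \<le> B2"
    using continuous_periodic_bounded[OF assms(1) periodic_stationary_continuous[OF q(1)]] q(1)
    unfolding periodic_stationary_def by metis
  obtain B1 where B1: "\<And>x. \<bar>q1 x\<bar> \<le> B1"
    using continuous_periodic_bounded[OF assms(1) periodic_stationary_continuous[OF q(2)]] q(2)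
    unfolding periodic_stationary_def by metis
  obtain R where R: "R > 0"
    "\<And>t x. 0 \<le> t \<Longrightarrow> t \<le> T \<Longrightarrow> R \<le> x \<Longrightarrow> \<bar>u t x - q2 x\<bar> < 1"
    "\<And>t x. 0 \<le> t \<Longrightarrow> t \<le> T \<Longrightarrow> x \<le> - R \<Longrightarrow> \<bar>u t x - q1 x\<bar> < 1"
    using pulsating_wave_far_bounded_time[OF assms(2), of 1 T] by auto
  have "compact ((\<lambda>(t, x). u t x) ` ({0..T} \<times> {-R..R}))"
    by (intro compact_continuous_image continuous_on_subset[OF entire_solution_continuous[OF q(3)]]
        compact_Times) auto
  then obtain B where B: "\<And>t x. t \<in> {0..T} \<Longrightarrow> x \<in> {-R..R} \<Longrightarrow> \<bar>u t x\<bar> \<le> B"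
    by (fastforce dest: compact_imp_bounded simp: bounded_iff)
  have "\<bar>u t x\<bar> \<le> max B (max (B1 + 1) (B2 + 1))" if "0 \<le> t" "t \<le> T" for t x
  proof -
    consider "R \<le> x" | "x \<le> - R" | "x \<in> {-R..R}" by force
    then show ?thesis
    proof cases
      case 1 then show ?thesis using R(2)[OF that 1] B2[of x] by linarith
    next
      case 2 then show ?thesis using R(3)[OF that 2] B1[of x] by linarith
    next
      case 3 then show ?thesis using B[of t x] that by auto
    qed
  qed
  then show thesis using that by blast
qed

section \<open>Forward comparison and uniqueness for waves\<close>

lemma pulsating_wave_le_forward:
  assumes L: "L > 0" and a: "C2_real a" "\<And>x. a x > 0"
    and f: "C1_real2 f" "\<And>x u. f (x + L) u = f x u"
    and u: "pulsating_wave L a f q2 q1 c u" and v: "pulsating_wave L a f q2 q1 c' v"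
    and init: "\<And>x. u 0 x \<le> v 0 x" and T: "0 \<le> T"
  shows "u T x \<le> v T x"
proof -
  obtain M1 where M1: "\<And>t x. 0 \<le> t \<Longrightarrow> t \<le> T \<Longrightarrow> \<bar>u t x\<bar> \<le> M1"
    using pulsating_wave_bounded[OF L u, of T] by auto
  obtain M2 where M2: "\<And>t x. 0 \<le> t \<Longrightarrow> t \<le> T \<Longrightarrow> \<bar>v t x\<bar> \<le> M2"
    using pulsating_wave_bounded[OF L v, of T] by auto
  \<comment> \<open>\<open>f\<close> is Lipschitz in \<open>u\<close> only on bounded ranges, hence
    the common bound for both waves.\<close>
  obtain K where K: "\<And>x u v. \<bar>u\<bar> \<le> max M1 M2 \<Longrightarrow> \<bar>v\<bar> \<le> max M1 M2 \<Longrightarrow>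
      \<bar>f x u - f x v\<bar> \<le> K * \<bar>u - v\<bar>"
    using C1_real2_lipschitz[OF L f] by metis
  show ?thesis
  proof (rule parabolic_comparison[where u = u and v = v, OF a _ _ _ _ init T order_refl])
    show "entire_solution a f u" "entire_solution a f v"
      using u v unfolding pulsating_wave_def by auto
    show "\<bar>f x (u t x) - f x (v t x)\<bar> \<le> K * \<bar>u t x - v t x\<bar>" if "0 \<le> t" "t \<le> T" for t x
      using M1[OF that, of x] M2[OF that, of x] by (intro K) auto
    fix e :: real assume "e > 0"
    then have "e / 2 > 0" by simp
    obtain R1 where R1: "R1 > 0"
      "\<And>t x. 0 \<le> t \<Longrightarrow> t \<le> T \<Longrightarrow> R1 \<le> x \<Longrightarrow> \<bar>u t x - q2 x\<bar> < e / 2"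
      "\<And>t x. 0 \<le> t \<Longrightarrow> t \<le> T \<Longrightarrow> x \<le> - R1 \<Longrightarrow> \<bar>u t x - q1 x\<bar> < e / 2"
      using pulsating_wave_far_bounded_time[OF u \<open>e / 2 > 0\<close>, of T] by auto
    obtain R2 where R2: "R2 > 0"
      "\<And>t x. 0 \<le> t \<Longrightarrow> t \<le> T \<Longrightarrow> R2 \<le> x \<Longrightarrow> \<bar>v t x - q2 x\<bar> < e / 2"
      "\<And>t x. 0 \<le> t \<Longrightarrow> t \<le> T \<Longrightarrow> x \<le> - R2 \<Longrightarrow> \<bar>v t x - q1 x\<bar> < e / 2"
      using pulsating_wave_far_bounded_time[OF v \<open>e / 2 > 0\<close>, of T] by auto
    \<comment> \<open>Both waves have the same end states, so they are close to each other far out,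
      whatever their speeds.\<close>
    have "\<bar>u t x - v t x\<bar> \<le> e" if t: "0 \<le> t" "t \<le> T" and x: "max R1 R2 \<le> \<bar>x\<bar>" for t x
    proof (cases "x \<ge> 0")
      case True
      then have "R1 \<le> x" "R2 \<le> x" using x by auto
      then show ?thesis using R1(2)[OF t, of x] R2(2)[OF t, of x] by linarith
    next
      case False
      then have "x \<le> - R1" "x \<le> - R2" using x by auto
      then show ?thesis using R1(3)[OF t, of x] R2(3)[OF t, of x] by linarith
    qed
    then show "\<exists>R. \<forall>t x. 0 \<le> t \<longrightarrow> t \<le> T \<longrightarrow> R \<le> \<bar>x\<bar> \<longrightarrow> \<bar>u t x - v t x\<bar> \<le> e" by blast
  qed
qed

text \<open>Comparison applies in both directions. The speeds may differ, and the case
  \<open>v = u\<close> turns a repeated profile into periodicity in time.\<close>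

lemma pulsating_wave_forward_unique:
  assumes L: "L > 0" and a: "C2_real a" "\<And>x. a x > 0"
    and f: "C1_real2 f" "\<And>x u. f (x + L) u = f x u"
    and u: "pulsating_wave L a f q2 q1 c u" and v: "pulsating_wave L a f q2 q1 c' v"
    and init: "u t1 = v t2" and T: "0 \<le> T"
  shows "u (t1 + T) = v (t2 + T)"
proof
  fix x
  note u' = pulsating_wave_time_shift[OF u, of t1] and v' = pulsating_wave_time_shift[OF v, of t2]
  have "u (T + t1) x \<le> v (T + t2) x"
    by (rule pulsating_wave_le_forward[OF L a f u' v' _ T]) (simp add: init)
  moreover have "v (T + t2) x \<le> u (T + t1) x"
    by (rule pulsating_wave_le_forward[OF L a f v' u' _ T]) (simp add: init)
  ultimately show "u (t1 + T) x = v (t2 + T) x"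
    by (simp add: add.commute[of _ T])
qed

section \<open>Intermediate values in space and time, and distinctness of profiles\<close>

lemma pulsating_wave_space_limits:
  assumes "pulsating_wave L a f q2 q1 c u"
  shows "((\<lambda>x. u t x - q2 x) \<longlongrightarrow> 0) at_top" "((\<lambda>x. u t x - q1 x) \<longlongrightarrow> 0) at_bot"
proof -
  have "eventually (\<lambda>x. \<bar>u t x - q2 x\<bar> < e) at_top \<and> eventually (\<lambda>x. \<bar>u t x - q1 x\<bar> < e) at_bot"
    if e: "e > 0" for e
  proof -
    obtain Z where Z: "\<And>t x. x - c * t \<ge> Z \<Longrightarrow> \<bar>u t x - q2 x\<bar> < e"
      "\<And>t x. x - c * t \<le> - Z \<Longrightarrow> \<bar>u t x - q1 x\<bar> < e"
      using pulsating_wave_far[OF assms e] by metis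
    have "\<forall>x\<ge>Z + c * t. \<bar>u t x - q2 x\<bar> < e" "\<forall>x\<le>c * t - Z. \<bar>u t x - q1 x\<bar> < e"
      using Z[where t = t] by (simp_all add: algebra_simps)
    then show ?thesis
      unfolding eventually_at_top_linorder eventually_at_bot_linorder by blast
  qed
  then show "((\<lambda>x. u t x - q2 x) \<longlongrightarrow> 0) at_top" "((\<lambda>x. u t x - q1 x) \<longlongrightarrow> 0) at_bot"
    by (auto simp: tendsto_iff dist_real_def)
qed

text \<open>At a fixed time the wave is near \<open>q1\<close> on the far left and near
  \<open>q2\<close> on the far right, so it crosses their mean.\<close>

lemma pulsating_wave_meets_mean:
  assumes L: "L > 0" and v: "pulsating_wave L a f q2 q1 c v" and q: "\<And>x. q2 x < q1 x"
  obtains x where "v t x = (q1 x + q2 x) / 2"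
proof -
  have ps: "periodic_stationary L a f q2" "periodic_stationary L a f q1" "entire_solution a f v"
    using v unfolding pulsating_wave_def by auto
  note cont = periodic_stationary_continuous[OF ps(1)] periodic_stationary_continuous[OF ps(2)]
    entire_solution_continuous_space[OF ps(3)]
  have per: "q2 (x + L) = q2 x" "q1 (x + L) = q1 x" for x
    using ps unfolding periodic_stationary_def by auto
  \<comment> \<open>An upper bound for this periodic reciprocal is a positive lower bound for the
    gap between the end states.\<close>
  have "continuous_on UNIV (\<lambda>x. inverse (q1 x - q2 x))"
    using q by (intro continuous_intros cont) (metis diff_gt_0_iff_gt less_irrefl)
  then obtain B where B: "\<And>x. \<bar>inverse (q1 x - q2 x)\<bar> \<le> B"
    using continuous_periodic_bounded[OF L, of "\<lambda>x. inverse (q1 x - q2 x)"] per by auto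
  have gap_pos: "inverse (q1 x - q2 x) > 0" for x using q[of x] by simp
  have Bpos: "B > 0" using B[of 0] gap_pos[of 0] by linarith
  have gap: "inverse B \<le> q1 x - q2 x" for x
    using le_imp_inverse_le[of "inverse (q1 x - q2 x)" B] B[of x] gap_pos[of x] by simp
  \<comment> \<open>The mean lies at least \<open>e\<close> from each end state, so closeness
    \<open>e\<close> to an end state decides the side of the mean.\<close>
  define e where "e = inverse B / 2"
  have e: "e > 0" using Bpos by (simp add: e_def)
  have gap: "2 * e \<le> q1 x - q2 x" for x
    using gap[of x] by (simp add: e_def)
  obtain Z1 where Z1: "\<And>x. x \<ge> Z1 \<Longrightarrow> \<bar>v t x - q2 x\<bar> < e"
    using pulsating_wave_space_limits(1)[OF v, of t] e
    unfolding tendsto_iff eventually_at_top_linorder dist_real_def by auto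
  obtain Z2 where Z2: "\<And>x. x \<le> Z2 \<Longrightarrow> \<bar>v t x - q1 x\<bar> < e"
    using pulsating_wave_space_limits(2)[OF v, of t] e
    unfolding tendsto_iff eventually_at_bot_linorder dist_real_def by auto
  let ?g = "\<lambda>x. v t x - (q1 x + q2 x) / 2"
  define r where "r = max \<bar>Z1\<bar> \<bar>Z2\<bar>"
  have "Z1 \<le> r" "- r \<le> Z2" by (auto simp: r_def)
  have "?g r \<le> 0"
    using Z1[OF \<open>Z1 \<le> r\<close>] gap[of r] by (simp add: abs_less_iff field_simps)
  moreover have "0 \<le> ?g (- r)"
    using Z2[OF \<open>- r \<le> Z2\<close>] gap[of "- r"] by (simp add: abs_less_iff field_simps)
  moreover have "continuous_on {- r..r} ?g"
    by (intro continuous_on_diff continuous_on_divide continuous_on_add continuous_on_const cont) simp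
  moreover have "- r \<le> r" by (auto simp: r_def)
  ultimately obtain x where "?g x = 0"
    using IVT2'[of ?g r 0 "- r"] by blast
  then show thesis using that by simp
qed

text \<open>Conditions on \<open>c * t\<close> instead of \<open>t\<close> treat both directions of
  motion at once; for nonzero \<open>c\<close> this product takes every real value.\<close>

lemma pulsating_wave_time_limits:
  assumes u: "pulsating_wave L a f q2 q1 c u" and c: "c \<noteq> 0" and e: "e > 0"
  obtains S where "\<And>t. c * t \<le> - S \<Longrightarrow> \<bar>u t x - q2 x\<bar> < e" "\<And>t. c * t \<ge> S \<Longrightarrow> \<bar>u t x - q1 x\<bar> < e"
proof -
  obtain Z where Z: "\<And>t x. x - c * t \<ge> Z \<Longrightarrow> \<bar>u t x - q2 x\<bar> < e"
    "\<And>t x. x - c * t \<le> - Z \<Longrightarrow> \<bar>u t x - q1 x\<bar> < e"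
    using pulsating_wave_far[OF u e] by metis
  show thesis
    by (rule that[of "\<bar>Z\<bar> + \<bar>x\<bar>"]; rule Z) linarith+
qed

text \<open>A wave of nonzero speed sweeps past the fixed point \<open>x\<close>, going from near
  one end state to near the other; connectedness of the time axis supplies the values
  between.\<close>

lemma pulsating_wave_attains:
  assumes u: "pulsating_wave L a f q2 q1 c u" and c: "c \<noteq> 0" and y: "q2 x < y" "y < q1 x"
  obtains t where "u t x = y"
proof -
  define e where "e = min (y - q2 x) (q1 x - y)"
  have "e > 0" using y by (simp add: e_def)
  then obtain S where S: "\<And>t. c * t \<le> - S \<Longrightarrow> \<bar>u t x - q2 x\<bar> < e"
    "\<And>t. c * t \<ge> S \<Longrightarrow> \<bar>u t x - q1 x\<bar> < e"
    using pulsating_wave_time_limits[OF u c] by metis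
  have cont: "continuous_on UNIV (\<lambda>t. u t x)"
    using u entire_solution_continuous_time unfolding pulsating_wave_def by blast
  have "u (- S / c) x \<le> y" "y \<le> u (S / c) x"
    using S(1)[of "- S / c"] S(2)[of "S / c"] c by (auto simp: e_def)
  then have "y \<in> (\<lambda>t. u t x) ` UNIV"
    using connectedD_interval[OF connected_continuous_image[OF cont connected_UNIV]] by blast
  then show thesis using that by auto
qed

text \<open>A repeated profile would recur forever by forward uniqueness, while a moving wave tends
  at each point to an end state. The profile would then equal that end state and could not meet the
  mean.\<close>

lemma pulsating_wave_profiles_distinct:
  assumes L: "L > 0" and a: "C2_real a" "\<And>x. a x > 0"
    and f: "C1_real2 f" "\<And>x u. f (x + L) u = f x u"
    and u: "pulsating_wave L a f q2 q1 c u" and c: "c \<noteq> 0" and q: "\<And>x. q2 x < q1 x"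
    and eq: "u t1 = u t2"
  shows "t1 = t2"
proof -
  have no: False if lt: "s1 < s2" and eq: "u s1 = u s2" for s1 s2
  proof -
    define T where "T = s2 - s1"
    have T: "T > 0" using lt by (simp add: T_def)
    have per: "u (s1 + real n * T) = u s1" for n
    proof (induction n)
      case (Suc n)
      have "u (s1 + real n * T + T) = u (s1 + T)"
        by (rule pulsating_wave_forward_unique[OF L a f u u Suc]) (use T in simp)
      then show ?case using eq by (simp add: T_def algebra_simps)
    qed simp
    \<comment> \<open>The end state approached as time tends to plus infinity: the left one if the
      wave moves right, otherwise the right one.\<close>
    define qq where "qq = (if c > 0 then q1 else q2)"
    have "\<bar>u s1 x - qq x\<bar> < e" if e: "e > 0" for x e
    proof -
      obtain S where S: "\<And>t. c * t \<le> - S \<Longrightarrow> \<bar>u t x - q2 x\<bar> < e"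
        "\<And>t. c * t \<ge> S \<Longrightarrow> \<bar>u t x - q1 x\<bar> < e"
        using pulsating_wave_time_limits[OF u c e] by metis
      obtain n :: nat where "(S / \<bar>c\<bar> - s1) / T < real n"
        using reals_Archimedean2 by blast
      then have "S < \<bar>c\<bar> * (s1 + real n * T)"
        using T c by (simp add: field_simps)
      then show ?thesis
        using S[of "s1 + real n * T"] c per[of n] by (auto simp: qq_def abs_if split: if_splits)
    qed
    \<comment> \<open>A positive distance would be strictly less than itself.\<close>
    from this[of "\<bar>u s1 x - qq x\<bar>" x for x] have "u s1 x = qq x" for x
      by fastforce
    moreover obtain x where "u s1 x = (q1 x + q2 x) / 2"
      using pulsating_wave_meets_mean[OF L u q] by metis
    ultimately show False using q[of x] by (auto simp: qq_def field_simps split: if_splits)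
  qed
  show ?thesis using no[of t1 t2] no[of t2 t1] eq by force
qed

section \<open>Mutually steeper waves\<close>

lemma mutually_steeper_imp_eq:
  assumes "steeper u v" "steeper v u" "u t1 x1 = v t2 x1"
  shows "u t1 = v t2"
proof
  fix x
  \<comment> \<open>On each side of the meeting point the two steepness relations give opposite
    inequalities.\<close>
  show "u t1 x = v t2 x"
    using assms(1)[unfolded steeper_def, rule_format, OF assms(3)]
      assms(2)[unfolded steeper_def, rule_format, OF assms(3)[symmetric]]
    by (cases "x \<le> x1") (auto intro: antisym)
qed

lemma mutually_steeper_waves_time_shift:
  assumes L: "L > 0" and a: "C2_real a" "\<And>x. a x > 0"
    and f: "C1_real2 f" "\<And>x u. f (x + L) u = f x u"
    and u: "pulsating_wave L a f q2 q1 c u" and c: "c \<noteq> 0" and q: "\<And>x. q2 x < q1 x"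
    and v: "pulsating_wave L a f q2 q1 c' v"
    and steep: "steeper u v" "steeper v u"
  shows "\<exists>s. \<forall>t. v t = u (t + s)"
proof -
  have "\<exists>\<tau>. u \<tau> = v t" for t
  proof -
    \<comment> \<open>The definition of a wave does not place \<open>v\<close> between its end
      states; at a point where \<open>v t\<close> equals their mean this is certain, so
      \<open>u\<close> attains the value there.\<close>
    obtain x where x: "v t x = (q1 x + q2 x) / 2"
      using pulsating_wave_meets_mean[OF L v q] by metis
    obtain \<tau> where "u \<tau> x = v t x"
      using pulsating_wave_attains[OF u c, of x "v t x"] q[of x] x by auto
    then show ?thesis using mutually_steeper_imp_eq[OF steep] by blast
  qed
  then obtain \<tau> where \<tau>: "\<And>t. u (\<tau> t) = v t" by metis
  note forward = pulsating_wave_forward_unique[OF L a f u v]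
  have "v t = u (t + \<tau> 0)" for t
  proof (cases "t \<ge> 0")
    case True
    then show ?thesis using forward[OF \<tau>[of 0] True] by (simp add: add.commute)
  next
    \<comment> \<open>For negative \<open>t\<close> no backward uniqueness is invoked: both waves
      are run forward from \<open>t\<close> to 0, and distinctness of the profiles of
      \<open>u\<close> identifies the times.\<close>
    case False
    then have "u (\<tau> t - t) = u (\<tau> 0)"
      using forward[OF \<tau>[of t], of "- t"] \<tau>[of 0] by simp
    then have "\<tau> t - t = \<tau> 0"
      by (rule pulsating_wave_profiles_distinct[OF L a f u c q])
    then show ?thesis using \<tau>[of t] by (simp add: algebra_simps)
  qed
  then show ?thesis by blast
qed

section \<open>Uniqueness of the minimal terrace\<close>

lemma terrace_with_speeds_sorted:
  assumes "terrace_with_speeds L a f p ps Us cs"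
  shows "sorted_wrt (\<lambda>q r. \<forall>x. r x < q x) ps"
proof -
  have "transp (\<lambda>(q :: real \<Rightarrow> real) r. \<forall>x. r x < q x)"
    by (auto intro!: transpI intro: less_trans)
  then show ?thesis
    using assms unfolding terrace_with_speeds_def
    by (subst sorted_wrt_iff_nth_Suc_transp) auto
qed

theorem theorem1p12:
  fixes L :: real and a p :: "real \<Rightarrow> real" and f :: "real \<Rightarrow> real \<Rightarrow> real"
    and ps :: "(real \<Rightarrow> real) list" and Us :: "(real \<Rightarrow> real \<Rightarrow> real) list" and cs :: "real list"
  assumes "L > 0"
    and "C2_real a" and "\<forall>x. a x > 0" and "\<forall>x. a (x + L) = a x"
    and "C1_real2 f" and "\<forall>x u. f (x + L) u = f x u" and "\<forall>x. f x 0 = 0"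
    and "periodic_stationary L a f p" and "\<forall>x. p x > 0"
    and "minimal_terrace L a f p ps Us"
    and "terrace_with_speeds L a f p ps Us cs" and "\<forall>c\<in>set cs. c \<noteq> 0"
  shows "\<forall>ps' Us'. minimal_terrace L a f p ps' Us' \<longrightarrow> equal_up_to_time_shifts ps Us ps' Us'"
proof (intro allI impI)
  fix ps' Us' assume min': "minimal_terrace L a f p ps' Us'"
  have semi: "semi_minimal_terrace L a f p ps Us" "semi_minimal_terrace L a f p ps' Us'"
    using assms(10) min' unfolding minimal_terrace_def by auto
  then have terr: "propagating_terrace L a f p ps Us" "propagating_terrace L a f p ps' Us'"
    unfolding semi_minimal_terrace_def by auto
  obtain cs' where cs': "terrace_with_speeds L a f p ps' Us' cs'"
    using terr(2) unfolding propagating_terrace_def by blast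
  \<comment> \<open>Minimality compares only with other terraces, so the identical pair is a
    separate case; otherwise each set contains the other.\<close>
  have "set ps = set ps'"
  proof (cases "(ps, Us) = (ps', Us')")
    case False
    then show ?thesis
      using assms(10) min' terr unfolding minimal_terrace_def by (intro subset_antisym) auto
  qed simp
  moreover have "asymp (\<lambda>(q :: real \<Rightarrow> real) r. \<forall>x. r x < q x)"
    by (rule asympI) (metis less_asym)
  ultimately have ps: "ps' = ps"
    by (intro sorted_wrt_set_unique[OF _ terrace_with_speeds_sorted[OF cs']
          terrace_with_speeds_sorted[OF assms(11)]]) auto
  have len: "length Us' = length Us"
    using assms(11) cs' ps unfolding terrace_with_speeds_def by auto
  have "\<exists>s. \<forall>t x. (Us' ! k) t x = (Us ! k) (t + s) x" if k: "k < length Us" for k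
  \<comment> \<open>Semi-minimality likewise speaks only of different waves; equal waves differ by
    the shift 0.\<close>
  proof (cases "Us' ! k = Us ! k")
    case True
    then show ?thesis by (auto intro: exI[of _ 0])
  next
    case False
    have u: "pulsating_wave L a f (ps ! Suc k) (ps ! k) (cs ! k) (Us ! k)"
      and q: "\<And>x. (ps ! Suc k) x < (ps ! k) x" and "length cs = length Us"
      using assms(11) k unfolding terrace_with_speeds_def by auto
    \<comment> \<open>Only the given terrace is known to have nonzero speeds; \<open>cs' ! k\<close>
      stays arbitrary.\<close>
    then have c: "cs ! k \<noteq> 0" using assms(12) k by auto
    have v: "pulsating_wave L a f (ps ! Suc k) (ps ! k) (cs' ! k) (Us' ! k)"
      using cs' k len ps unfolding terrace_with_speeds_def by auto
    \<comment> \<open>The waves share their end states, so each is a competitor in the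
      semi-minimality of the other terrace.\<close>
    have "steeper (Us ! k) (Us' ! k)" "steeper (Us' ! k) (Us ! k)"
      using semi u v k len ps False unfolding semi_minimal_terrace_def by metis+
    then show ?thesis
      using mutually_steeper_waves_time_shift[OF assms(1,2) _ assms(5) _ u c q v]
        assms(3,6) by (metis (no_types))
  qed
  then show "equal_up_to_time_shifts ps Us ps' Us'"
    unfolding equal_up_to_time_shifts_def using ps len by auto
qed

end
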